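(* Let $\mathcal{A}_m\subset\Omega_{n_m}$ ($m=1,2,\dots$) be a sequence of events and suppose that $I\!I(\mathcal{A}_m)\to 0$ as $m\to\infty$. Then $\{\mathcal{A}_m\}$ is asymptotically noise sensitive. Equivalently, there is a continuous function $\Phi:[0,\infty)\times(0,1/2)\to[0,\infty)$ satisfying $\Phi(0,\epsilon)=0$ for all $\epsilon\in(0,1/2)$ such that $\phi(\mathcal{A},\epsilon)\le\Phi\bigl(I\!I(\mathcal{A}),\epsilon\bigr)$ for every $n\ge 1$, every event $\mathcal{A}\subset\Omega_n$ and every $\epsilon\in(0,1/2)$.
   Context: $\Omega_n=\{0,1\}^n$ carries the uniform probability measure $\mathbf{P}$; an event is a subset $\mathcal{A}\subset\Omega_n$. Influences: for $x\in\Omega_n$ and $j\in\{1,\dots,n\}$, $\sigma_jx$ is $x$ with the $j$-th coordinate replaced by $1-x_j$. For $f:\Omega_n\to\mathbb{R}$, $I_k(f)=\|f(\sigma_kx)-f(x)\|_1=\mathbf{E}|f(\sigma_kx)-f(x)|$ (with $x$ uniform), and $I\!I(f)=\sum_{k=1}^n I_k(f)^2$. For an event, $I\!I(\mathcal{A})=I\!I(\chi_{\mathcal{A}})$, where $\chi_{\mathcal{A}}$ is the indicator function. Noise: for $x\in\Omega_n$ and $\epsilon\in(0,1)$, $N_\epsilon(x)$ is the random element of $\Omega_n$ whose coordinates are, independently, $x_j$ with probability $1-\epsilon$ and $1-x_j$ with probability $\epsilon$. Sensitivity gauge: for an event $\mathcal{A}\subset\Omega_n$ and $\delta>0$, let $$\gamma(\mathcal{A},\epsilon,\delta)=\mathbf{P}\Bigl\{x\in\Omega_n:\bigl|\mathbf{P}(N_\epsilon(x)\in\mathcal{A}\mid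 x)-\mathbf{P}(\mathcal{A})\bigr|>\delta\Bigr\},\qquad \phi(\mathcal{A},\epsilon)=\inf\{\delta>0:\gamma(\mathcal{A},\epsilon,\delta)<\delta\}.$$ A sequence of events $\mathcal{A}_m\subset\Omega_{n_m}$ is asymptotically noise sensitive if $\lim_{m\to\infty}\phi(\mathcal{A}_m,\epsilon)=0$ for every $\epsilon\in(0,1/2)$. *)

theory Defs
  imports "HOL-Probability.Probability"
begin

(* Points are extensional functions: undefined outside {1..n}. *)
definition Omega :: "nat \<Rightarrow> (nat \<Rightarrow> nat) set" where
  "Omega n = {1..n} \<rightarrow>\<^sub>E {0, 1}"

definition unif :: "nat \<Rightarrow> (nat \<Rightarrow> nat) pmf" where
  "unif n = pmf_of_set (Omega n)"

definition flip :: "nat \<Rightarrow> (nat \<Rightarrow> nat) \<Rightarrow> (nat \<Rightarrow> nat)" where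
  "flip j x = x(j := 1 - x j)"

definition influence :: "nat \<Rightarrow> ((nat \<Rightarrow> nat) \<Rightarrow> real) \<Rightarrow> nat \<Rightarrow> real" where
  "influence n f k = measure_pmf.expectation (unif n) (\<lambda>x. \<bar>f (flip k x) - f x\<bar>)"

definition II :: "nat \<Rightarrow> ((nat \<Rightarrow> nat) \<Rightarrow> real) \<Rightarrow> real" where
  "II n f = (\<Sum>k=1..n. (influence n f k)\<^sup>2)"

definition II_event :: "nat \<Rightarrow> (nat \<Rightarrow> nat) set \<Rightarrow> real" where
  "II_event n A = II n (indicat_real A)"

(* The Bernoulli(eps) bit b says whether coordinate j is flipped. The default value undefined
   of the product makes its samples extensional, i.e. elements of Omega n. *)
definition noise :: "nat \<Rightarrow> real \<Rightarrow> (nat \<Rightarrow> nat) \<Rightarrow> (nat \<Rightarrow> nat) pmf" where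
  "noise n \<epsilon> x =
     Pi_pmf {1..n} undefined (\<lambda>j. map_pmf (\<lambda>b. if b then 1 - x j else x j) (bernoulli_pmf \<epsilon>))"

definition gauge_prob :: "nat \<Rightarrow> (nat \<Rightarrow> nat) set \<Rightarrow> real \<Rightarrow> real \<Rightarrow> real" where
  "gauge_prob n A \<epsilon> \<delta> =
     measure_pmf.prob (unif n)
       {x \<in> Omega n. \<bar>measure_pmf.prob (noise n \<epsilon> x) A - measure_pmf.prob (unif n) A\<bar> > \<delta>}"

definition sens_gauge :: "nat \<Rightarrow> (nat \<Rightarrow> nat) set \<Rightarrow> real \<Rightarrow> real" where
  "sens_gauge n A \<epsilon> = Inf {\<delta>. \<delta> > 0 \<and> gauge_prob n A \<epsilon> \<delta> < \<delta>}"

definition asymp_noise_sensitive :: "(nat \<Rightarrow> nat) \<Rightarrow> (nat \<Rightarrow> (nat \<Rightarrow> nat) set) \<Rightarrow> bool" where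
  "asymp_noise_sensitive n A \<longleftrightarrow>
     (\<forall>\<epsilon>\<in>{0<..<1/2}. (\<lambda>m. sens_gauge (n m) (A m) \<epsilon>) \<longlonglongrightarrow> 0)"

end

theory Submission
  imports Defs
begin

text \<open>
  Write \<open>T\<^sub>\<rho>\<close> for the noise operator, which multiplies the Walsh coefficient of \<open>S\<close> by \<open>\<rho> ^ card S\<close>,
  and \<open>D\<^sub>k f\<close> for the discrete partial derivatives of \<open>f\<close>, so that the \<open>L\<^sup>1\<close> norm of \<open>D\<^sub>k f\<close> is
  half the \<open>k\<close>-th influence. Put \<open>F\<^sub>k = T\<^sub>\<rho> D\<^sub>k f\<close> with \<open>\<rho> = 1 / sqrt 2\<close>. Bonami's inequality and
  interpolation between \<open>L\<^sup>1\<close> and \<open>L\<^sup>2\<close> show that applying noise of parameter \<open>1 / sqrt 3\<close> to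
  \<open>F\<^sub>k\<close> gives a function whose squared \<open>L\<^sup>2\<close> norm is at most the product of the \<open>L\<^sup>1\<close> and
  \<open>L\<^sup>2\<close> norms of \<open>F\<^sub>k\<close>. The first factor is at most the influence, and by Parseval the squares of the second sum
  to at most \<open>1\<close> because \<open>j \<le> 2 ^ (j - 1)\<close>. Summing over \<open>k\<close> with the Cauchy-Schwarz inequality
  bounds the Walsh weights of \<open>f\<close> damped by \<open>(1 / 6) ^ card S\<close> by the square root of \<open>II\<close>.
  By concavity this becomes a bound on the variance of \<open>T\<^sub>\<rho> f\<close> for every \<open>\<rho> < 1\<close>, and Chebyshev's
  inequality turns it into a bound on the sensitivity gauge.
\<close>

section \<open>Walsh analysis on the cube\<close>

definition avg :: "nat \<Rightarrow> ((nat \<Rightarrow> nat) \<Rightarrow> real) \<Rightarrow> real" where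
  "avg n f = (\<Sum>x\<in>Omega n. f x) / 2 ^ n"

text \<open>The Walsh character of \<open>S\<close>: on bits, \<open>1 - 2 * real (x j)\<close> is
  the sign (-1)^(x j).\<close>

definition chi :: "nat set \<Rightarrow> (nat \<Rightarrow> nat) \<Rightarrow> real" where
  "chi S x = (\<Prod>j\<in>S. 1 - 2 * real (x j))"

text \<open>The frequency set \<open>J\<close> is a parameter so that hypercontractivity can be
  proved by adding one coordinate at a time.\<close>

definition walsh :: "nat set \<Rightarrow> (nat set \<Rightarrow> real) \<Rightarrow> (nat \<Rightarrow> nat) \<Rightarrow> real" where
  "walsh J c x = (\<Sum>S\<in>Pow J. c S * chi S x)"

definition fourier :: "nat \<Rightarrow> ((nat \<Rightarrow> nat) \<Rightarrow> real) \<Rightarrow> nat set \<Rightarrow> real" where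
  "fourier n f S = avg n (\<lambda>x. f x * chi S x)"

lemma finite_Omega [simp]: "finite (Omega n)"
  by (auto simp: Omega_def intro: finite_PiE)

lemma card_Omega [simp]: "card (Omega n) = 2 ^ n"
  by (simp add: Omega_def card_PiE numeral_2_eq_2)

lemma Omega_nonempty [simp]: "Omega n \<noteq> {}"
  using card_Omega[of n] by (metis card.empty power_not_zero zero_neq_numeral)

lemma Omega_cases: "x \<in> Omega n \<Longrightarrow> j \<in> {1..n} \<Longrightarrow> x j = 0 \<or> x j = 1"
  by (auto simp: Omega_def PiE_def Pi_def)

lemma expectation_unif: "measure_pmf.expectation (unif n) f = avg n f"
  by (simp add: unif_def integral_pmf_of_set avg_def)

lemma avg_cong: "(\<And>x. x \<in> Omega n \<Longrightarrow> f x = g x) \<Longrightarrow> avg n f = avg n g"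
  by (simp add: avg_def)

lemma avg_mono: "(\<And>x. x \<in> Omega n \<Longrightarrow> f x \<le> g x) \<Longrightarrow> avg n f \<le> avg n g"
  by (auto simp: avg_def intro!: divide_right_mono sum_mono)

lemma avg_nonneg: "(\<And>x. x \<in> Omega n \<Longrightarrow> 0 \<le> f x) \<Longrightarrow> 0 \<le> avg n f"
  by (auto simp: avg_def intro!: divide_nonneg_nonneg sum_nonneg)

lemma avg_const [simp]: "avg n (\<lambda>_. c) = c"
  by (simp add: avg_def)

lemma avg_add: "avg n (\<lambda>x. f x + g x) = avg n f + avg n g"
  by (simp add: avg_def sum.distrib add_divide_distrib)

lemma avg_diff: "avg n (\<lambda>x. f x - g x) = avg n f - avg n g"
  by (simp add: avg_def sum_subtractf diff_divide_distrib)

lemma avg_cmult: "avg n (\<lambda>x. c * f x) = c * avg n f"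
  by (simp add: avg_def sum_distrib_left)

lemma avg_sum: "avg n (\<lambda>x. \<Sum>i\<in>I. f i x) = (\<Sum>i\<in>I. avg n (f i))"
  unfolding avg_def by (subst sum.swap) (simp add: sum_divide_distrib)

lemma avg_Cauchy_Schwarz: "(avg n (\<lambda>x. f x * g x))\<^sup>2 \<le> avg n (\<lambda>x. (f x)\<^sup>2) * avg n (\<lambda>x. (g x)\<^sup>2)"
  using Cauchy_Schwarz_ineq_sum[of f g "Omega n"]
  by (simp add: avg_def power_divide power2_eq_square divide_right_mono)

section \<open>Coordinate flips, parity and orthonormality of the characters\<close>

lemma flip_in_Omega: "x \<in> Omega n \<Longrightarrow> j \<in> {1..n} \<Longrightarrow> flip j x \<in> Omega n"
  by (auto simp: Omega_def flip_def PiE_def Pi_def extensional_def)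

lemma flip_flip: "x \<in> Omega n \<Longrightarrow> j \<in> {1..n} \<Longrightarrow> flip j (flip j x) = x"
  using Omega_cases[of x n j] by (auto simp: flip_def fun_eq_iff)

lemma avg_flip:
  assumes "j \<in> {1..n}"
  shows "avg n (\<lambda>x. f (flip j x)) = avg n f"
  unfolding avg_def
  by (rule arg_cong[where f = "\<lambda>s. s / 2 ^ n"],
      rule sum.reindex_bij_witness[of _ "flip j" "flip j"])
     (use assms in \<open>auto simp: flip_in_Omega flip_flip\<close>)

text \<open>Flipping a coordinate preserves the uniform measure, so the mean of an odd function
  equals its own negative.\<close>

lemma avg_odd:
  assumes "j \<in> {1..n}" "\<And>x. x \<in> Omega n \<Longrightarrow> f (flip j x) = - f x"
  shows "avg n f = 0"
proof -
  have "avg n f = avg n (\<lambda>x. - f x)"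
    using avg_flip[OF assms(1), of f] assms(2) by (metis (mono_tags, lifting) avg_cong)
  also have "\<dots> = - avg n f"
    using avg_cmult[of n "-1" f] by simp
  finally show ?thesis by simp
qed

lemma chi_flip_notin: "j \<notin> S \<Longrightarrow> chi S (flip j x) = chi S x"
  unfolding chi_def flip_def by (rule prod.cong) auto

lemma chi_insert: "finite S \<Longrightarrow> j \<notin> S \<Longrightarrow> chi (insert j S) x = (1 - 2 * real (x j)) * chi S x"
  by (simp add: chi_def)

lemma chi_flip_in:
  assumes "finite S" "j \<in> S" "x \<in> Omega n" "j \<in> {1..n}"
  shows "chi S (flip j x) = - chi S x"
proof -
  obtain T where T: "S = insert j T" "j \<notin> T" "finite T"
    using assms by (metis finite_insert mk_disjoint_insert)
  then show ?thesis
    using Omega_cases[OF assms(3,4)] by (auto simp: chi_insert chi_flip_notin) (auto simp: flip_def)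
qed

lemma chi_sq:
  assumes "S \<subseteq> {1..n}" "x \<in> Omega n"
  shows "chi S x * chi S x = 1"
  unfolding chi_def prod.distrib[symmetric]
  by (rule prod.neutral) (use assms Omega_cases in force)

text \<open>For distinct \<open>S\<close> and \<open>T\<close>, a coordinate in exactly one of them
  makes the product of the characters odd under the corresponding flip.\<close>

lemma chi_orthonormal:
  assumes S: "S \<subseteq> {1..n}" and T: "T \<subseteq> {1..n}"
  shows "avg n (\<lambda>x. chi S x * chi T x) = (if S = T then 1 else 0)"
proof (cases "S = T")
  case True
  have "avg n (\<lambda>x. chi S x * chi T x) = avg n (\<lambda>_. 1)"
    by (rule avg_cong) (use chi_sq[OF S] True in auto)
  then show ?thesis using True by simp
next
  case False
  have fin: "finite S" "finite T" using S T finite_subset by blast+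
  obtain j where j: "j \<in> {1..n}" "j \<in> S \<longleftrightarrow> j \<notin> T" using False S T by blast
  have "avg n (\<lambda>x. chi S x * chi T x) = 0"
    by (rule avg_odd[OF j(1)]) (use j fin in \<open>cases "j \<in> S"; simp add: chi_flip_in chi_flip_notin\<close>)
  then show ?thesis using False by simp
qed

lemma parseval: "avg n (\<lambda>x. walsh {1..n} c x * walsh {1..n} d x) = (\<Sum>S\<in>Pow {1..n}. c S * d S)"
proof -
  have "avg n (\<lambda>x. walsh {1..n} c x * walsh {1..n} d x)
      = (\<Sum>S\<in>Pow {1..n}. \<Sum>T\<in>Pow {1..n}. c S * d T * avg n (\<lambda>x. chi S x * chi T x))"
    by (simp add: walsh_def sum_product avg_sum avg_cmult[symmetric] mult_ac)
  also have "\<dots> = (\<Sum>S\<in>Pow {1..n}. \<Sum>T\<in>Pow {1..n}. if S = T then c S * d T else 0)"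
    by (intro sum.cong refl) (simp add: chi_orthonormal)
  also have "\<dots> = (\<Sum>S\<in>Pow {1..n}. c S * d S)"
    by (intro sum.cong refl) (simp add: sum.delta)
  finally show ?thesis .
qed

section \<open>The noise operator and its kernel\<close>

text \<open>For \<rho> = 1 - 2\<epsilon> this is the transition probability of the noise from
  \<open>x\<close> to \<open>z\<close>: a factor is (1 + \<rho>)/2 = 1 - \<epsilon> where the bits
  agree and (1 - \<rho>)/2 = \<epsilon> where they differ.\<close>

definition kernel :: "nat \<Rightarrow> real \<Rightarrow> (nat \<Rightarrow> nat) \<Rightarrow> (nat \<Rightarrow> nat) \<Rightarrow> real" where
  "kernel n \<rho> x z = (\<Prod>j\<in>{1..n}. (1 + \<rho> * (1 - 2 * real (x j)) * (1 - 2 * real (z j))) / 2)"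

text \<open>Multiplying out the product over coordinates gives one term for each set of coordinates
  at which the non-constant summand is chosen.\<close>

lemma kernel_walsh: "kernel n \<rho> x z = walsh {1..n} (\<lambda>S. \<rho> ^ card S * chi S z) x / 2 ^ n"
proof -
  have "kernel n \<rho> x z =
      (\<Prod>j\<in>{1..n}. \<rho> * (1 - 2 * real (x j)) * (1 - 2 * real (z j)) + 1) / 2 ^ n"
    by (simp add: kernel_def prod_dividef add.commute)
  also have "(\<Prod>j\<in>{1..n}. \<rho> * (1 - 2 * real (x j)) * (1 - 2 * real (z j)) + 1)
      = walsh {1..n} (\<lambda>S. \<rho> ^ card S * chi S z) x"
    by (subst prod_add) (auto simp: walsh_def chi_def prod.distrib mult_ac)
  finally show ?thesis .
qed

text \<open>Damping Walsh coefficients is the same as averaging against the kernel. The first form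
  suits Parseval, the second positivity arguments and probabilities.\<close>

lemma noise_kernel:
  "walsh {1..n} (\<lambda>S. \<rho> ^ card S * fourier n f S) x = (\<Sum>z\<in>Omega n. kernel n \<rho> x z * f z)"
proof -
  have "walsh {1..n} (\<lambda>S. \<rho> ^ card S * fourier n f S) x
      = avg n (\<lambda>z. walsh {1..n} (\<lambda>S. \<rho> ^ card S * chi S z) x * f z)"
    by (simp add: walsh_def fourier_def sum_distrib_right sum_distrib_left avg_sum avg_cmult[symmetric]
        mult_ac)
  then show ?thesis
    by (simp add: kernel_walsh avg_def sum_divide_distrib)
qed

lemma kernel_sym: "kernel n \<rho> x z = kernel n \<rho> z x"
  by (simp add: kernel_def mult_ac)

lemma kernel_nonneg:
  assumes "0 \<le> \<rho>" "\<rho> \<le> 1" "x \<in> Omega n" "z \<in> Omega n"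
  shows "0 \<le> kernel n \<rho> x z"
  unfolding kernel_def
proof (rule prod_nonneg)
  fix j assume "j \<in> {1..n}"
  then show "0 \<le> (1 + \<rho> * (1 - 2 * real (x j)) * (1 - 2 * real (z j))) / 2"
    using Omega_cases[OF assms(3)] Omega_cases[OF assms(4)] assms(1,2) by fastforce
qed

lemma fourier_one: "S \<subseteq> {1..n} \<Longrightarrow> fourier n (\<lambda>_. 1) S = (if S = {} then 1 else 0)"
  using chi_orthonormal[of "{}" n S] by (auto simp: fourier_def chi_def)

text \<open>The operator fixes the constant 1, whose only nonzero Walsh coefficient sits at the
  empty set and is not damped.\<close>

lemma sum_kernel: "(\<Sum>z\<in>Omega n. kernel n \<rho> x z) = 1"
proof -
  have "(\<Sum>z\<in>Omega n. kernel n \<rho> x z) = walsh {1..n} (\<lambda>S. \<rho> ^ card S * fourier n (\<lambda>_. 1) S) x"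
    using noise_kernel[of n \<rho> "\<lambda>_. 1" x] by simp
  also have "\<dots> = (\<Sum>S\<in>Pow {1..n}. if S = {} then 1 else 0)"
    unfolding walsh_def by (intro sum.cong refl) (simp add: fourier_one chi_def)
  also have "\<dots> = 1" by (subst sum.delta) auto
  finally show ?thesis .
qed

lemma kernel_one:
  assumes "x \<in> Omega n" "z \<in> Omega n"
  shows "kernel n 1 x z = (if x = z then 1 else 0)"
proof (cases "x = z")
  case True
  then show ?thesis using assms Omega_cases[OF assms(1)]
    unfolding kernel_def by (force intro!: prod.neutral)
next
  case False
  then obtain j where "j \<in> {1..n}" "x j \<noteq> z j"
    using assms unfolding Omega_def by (metis PiE_ext)
  moreover from this have "(1 + 1 * (1 - 2 * real (x j)) * (1 - 2 * real (z j))) / 2 = 0"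
    using Omega_cases[OF assms(1), of j] Omega_cases[OF assms(2), of j] by auto
  ultimately have "kernel n 1 x z = 0"
    unfolding kernel_def by (intro prod_zero) auto
  with False show ?thesis by simp
qed

text \<open>The case \<rho> = 1 of \<open>noise_kernel\<close>, where the kernel is the identity
  matrix.\<close>

lemma fourier_inversion:
  assumes "x \<in> Omega n"
  shows "walsh {1..n} (fourier n f) x = f x"
proof -
  have "walsh {1..n} (fourier n f) x = (\<Sum>z\<in>Omega n. kernel n 1 x z * f z)"
    using noise_kernel[of n 1 f x] by simp
  also have "\<dots> = (\<Sum>z\<in>Omega n. if x = z then f z else 0)"
    by (intro sum.cong refl) (simp add: kernel_one assms)
  also have "\<dots> = f x" using assms by (simp add: sum.delta)
  finally show ?thesis .
qed

text \<open>The kernel is nonnegative and symmetric with row sums 1, so its column sums are 1 as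
  well.\<close>

lemma noise_L1_contraction:
  assumes "0 \<le> \<rho>" "\<rho> \<le> 1"
  shows "avg n (\<lambda>x. \<bar>walsh {1..n} (\<lambda>S. \<rho> ^ card S * fourier n f S) x\<bar>) \<le> avg n (\<lambda>x. \<bar>f x\<bar>)"
proof -
  have "avg n (\<lambda>x. \<bar>walsh {1..n} (\<lambda>S. \<rho> ^ card S * fourier n f S) x\<bar>)
      \<le> avg n (\<lambda>x. \<Sum>z\<in>Omega n. kernel n \<rho> x z * \<bar>f z\<bar>)"
  proof (rule avg_mono)
    fix x assume "x \<in> Omega n"
    then show "\<bar>walsh {1..n} (\<lambda>S. \<rho> ^ card S * fourier n f S) x\<bar>
        \<le> (\<Sum>z\<in>Omega n. kernel n \<rho> x z * \<bar>f z\<bar>)"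
      unfolding noise_kernel using assms
      by (intro order_trans[OF sum_abs] sum_mono) (simp add: abs_mult kernel_nonneg)
  qed
  also have "\<dots> = avg n (\<lambda>z. (\<Sum>x\<in>Omega n. kernel n \<rho> z x) * \<bar>f z\<bar>)"
    unfolding avg_def by (subst sum.swap) (simp add: sum_distrib_right kernel_sym)
  also have "\<dots> = avg n (\<lambda>z. \<bar>f z\<bar>)" by (simp add: sum_kernel)
  finally show ?thesis .
qed

section \<open>Hypercontractivity\<close>

text \<open>Separates the frequencies with and without \<open>j\<close>; by
  \<open>walsh_flip\<close> neither of the two Walsh sums on the right depends on coordinate
  \<open>j\<close>.\<close>

lemma walsh_insert:
  assumes "finite J" "j \<notin> J"
  shows "walsh (insert j J) c x
    = walsh J c x + (1 - 2 * real (x j)) * walsh J (\<lambda>S. c (insert j S)) x"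
proof -
  have "walsh (insert j J) c x
      = (\<Sum>S\<in>Pow J. c S * chi S x) + (\<Sum>S\<in>insert j ` Pow J. c S * chi S x)"
    unfolding walsh_def Pow_insert by (rule sum.union_disjoint) (use assms in auto)
  also have "(\<Sum>S\<in>insert j ` Pow J. c S * chi S x)
      = (\<Sum>S\<in>Pow J. c (insert j S) * chi (insert j S) x)"
    by (subst sum.reindex) (use assms in \<open>auto intro!: inj_onI simp: o_def\<close>)
  also have "\<dots> = (1 - 2 * real (x j)) * walsh J (\<lambda>S. c (insert j S)) x"
    unfolding walsh_def sum_distrib_left
    by (rule sum.cong[OF refl], subst chi_insert) (use assms finite_subset in \<open>auto simp: mult_ac\<close>)
  finally show ?thesis by (simp add: walsh_def)
qed

lemma sum_Pow_insert:
  assumes "finite J" "j \<notin> J"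
  shows "sum f (Pow (insert j J)) = sum f (Pow J) + (\<Sum>S\<in>Pow J. f (insert j S) :: real)"
proof -
  have "sum f (Pow (insert j J)) = sum f (Pow J) + sum f (insert j ` Pow J)"
    unfolding Pow_insert by (rule sum.union_disjoint) (use assms in auto)
  also have "sum f (insert j ` Pow J) = (\<Sum>S\<in>Pow J. f (insert j S))"
    by (subst sum.reindex) (use assms in \<open>auto intro!: inj_onI simp: o_def\<close>)
  finally show ?thesis .
qed

lemma walsh_flip: "j \<notin> J \<Longrightarrow> walsh J c (flip j x) = walsh J c x"
  unfolding walsh_def by (intro sum.cong refl, subst chi_flip_notin) auto

text \<open>Bonami's inequality from L2 to L4, raised to the fourth power, with the L2 norm written
  through the coefficients. In the induction the new coordinate enters as an independent sign: odd
  powers of it average out, and Cauchy-Schwarz handles the mixed square term.\<close>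

lemma hypercontractive:
  assumes "J \<subseteq> {1..n}"
  shows "avg n (\<lambda>x. (walsh J (\<lambda>S. (1 / sqrt 3) ^ card S * c S) x) ^ 4) \<le> (\<Sum>S\<in>Pow J. (c S)\<^sup>2)\<^sup>2"
proof -
  have "finite J" using assms finite_subset by blast
  then show ?thesis using assms
  proof (induction J arbitrary: c rule: finite_induct)
    case empty
    show ?case by (simp add: walsh_def chi_def)
  next
    case (insert j J)
    define p where "p = walsh J (\<lambda>S. (1 / sqrt 3) ^ card S * c S)"
    define r where "r = walsh J (\<lambda>S. (1 / sqrt 3) ^ card S * c (insert j S))"
    define s where "s x = 1 - 2 * real (x j)" for x :: "nat \<Rightarrow> nat"
    define A where "A = (\<Sum>S\<in>Pow J. (c S)\<^sup>2)"
    define B where "B = (\<Sum>S\<in>Pow J. (c (insert j S))\<^sup>2)"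
    have j: "j \<in> {1..n}" and J: "J \<subseteq> {1..n}" using insert.prems by auto
    have AB: "A \<ge> 0" "B \<ge> 0" by (auto simp: A_def B_def intro: sum_nonneg)
    have pA: "avg n (\<lambda>x. p x ^ 4) \<le> A\<^sup>2" and rB: "avg n (\<lambda>x. r x ^ 4) \<le> B\<^sup>2"
      unfolding p_def r_def A_def B_def by (rule insert.IH[OF J])+
    have pr: "avg n (\<lambda>x. (p x)\<^sup>2 * (r x)\<^sup>2) \<le> A * B"
    proof -
      have "(avg n (\<lambda>x. (p x)\<^sup>2 * (r x)\<^sup>2))\<^sup>2 \<le> avg n (\<lambda>x. p x ^ 4) * avg n (\<lambda>x. r x ^ 4)"
        using avg_Cauchy_Schwarz[of n "\<lambda>x. (p x)\<^sup>2" "\<lambda>x. (r x)\<^sup>2"] by (simp flip: power_mult)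
      also have "\<dots> \<le> A\<^sup>2 * B\<^sup>2"
        by (intro mult_mono pA rB avg_nonneg) auto
      finally show ?thesis
        using AB by (metis power_mult_distrib power2_le_imp_le mult_nonneg_nonneg)
    qed
    have s_flip: "s (flip j x) = - s x" "s x * s x = 1" if "x \<in> Omega n" for x
      using Omega_cases[OF that j] by (auto simp: s_def flip_def)
    have pr_flip: "p (flip j x) = p x" "r (flip j x) = r x" for x
      unfolding p_def r_def using insert.hyps by (simp_all add: walsh_flip)
    \<comment> \<open>These are the terms of the fourth power that are odd in the sign
      \<open>s\<close>; \<open>p\<close> and \<open>r\<close> do not see coordinate
      \<open>j\<close>.\<close>
    have "avg n (\<lambda>x. s x * (4 / sqrt 3 * p x ^ 3 * r x + 4 / (3 * sqrt 3) * p x * r x ^ 3)) = 0"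
      by (rule avg_odd[OF j]) (simp add: s_flip pr_flip)
    moreover have "avg n (\<lambda>x. (walsh (insert j J) (\<lambda>S. (1 / sqrt 3) ^ card S * c S) x) ^ 4)
      = avg n (\<lambda>x. (p x ^ 4 + 2 * ((p x)\<^sup>2 * (r x)\<^sup>2) + 1 / 9 * r x ^ 4)
          + s x * (4 / sqrt 3 * p x ^ 3 * r x + 4 / (3 * sqrt 3) * p x * r x ^ 3))"
    proof (rule avg_cong)
      fix x assume x: "x \<in> Omega n"
      have "walsh J (\<lambda>S. (1 / sqrt 3) ^ card (insert j S) * c (insert j S)) x = r x / sqrt 3"
        unfolding r_def walsh_def sum_divide_distrib
        by (intro sum.cong refl, subst card_insert_disjoint)
           (use insert.hyps finite_subset in auto)
      then have w: "walsh (insert j J) (\<lambda>S. (1 / sqrt 3) ^ card S * c S) x = p x + s x * (r x / sqrt 3)"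
        using insert.hyps by (simp add: walsh_insert p_def s_def)
      have *: "(p + s * u) ^ 4 = p ^ 4 + 6 * (p\<^sup>2 * u\<^sup>2) + u ^ 4 + s * (4 * p ^ 3 * u + 4 * p * u ^ 3)"
        if "s * s = 1" for p s u :: real
      proof -
        have s: "s\<^sup>2 = 1" "s ^ 3 = s" "s ^ 4 = 1"
          using that by (simp_all add: eval_nat_numeral)
        have "(p + s * u) ^ 4 = p ^ 4 + 6 * (s\<^sup>2 * (p\<^sup>2 * u\<^sup>2)) + s ^ 4 * u ^ 4
            + 4 * p ^ 3 * (s * u) + 4 * p * (s ^ 3 * u ^ 3)"
          by (simp add: eval_nat_numeral algebra_simps)
        then show ?thesis unfolding s by (simp add: algebra_simps)
      qed
      have "sqrt 3 ^ 3 = 3 * sqrt 3" "sqrt 3 ^ 4 = (9::real)"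
        by (simp_all add: eval_nat_numeral)
      then show "(walsh (insert j J) (\<lambda>S. (1 / sqrt 3) ^ card S * c S) x) ^ 4
        = (p x ^ 4 + 2 * ((p x)\<^sup>2 * (r x)\<^sup>2) + 1 / 9 * r x ^ 4)
          + s x * (4 / sqrt 3 * p x ^ 3 * r x + 4 / (3 * sqrt 3) * p x * r x ^ 3)"
        unfolding w *[OF s_flip(2)[OF x]] by (simp add: power_divide)
    qed
    ultimately have "avg n (\<lambda>x. (walsh (insert j J) (\<lambda>S. (1 / sqrt 3) ^ card S * c S) x) ^ 4)
        = avg n (\<lambda>x. p x ^ 4) + 2 * avg n (\<lambda>x. (p x)\<^sup>2 * (r x)\<^sup>2) + 1 / 9 * avg n (\<lambda>x. r x ^ 4)"
      by (simp only: avg_add avg_cmult)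
    also have "\<dots> \<le> A\<^sup>2 + 2 * (A * B) + 1 / 9 * B\<^sup>2"
      using pA pr rB by linarith
    \<comment> \<open>The constant 1 / sqrt 3 is chosen for this step: the binomial coefficient 6
      times its square is 2, exactly the cross coefficient of the square.\<close>
    also have "\<dots> \<le> (A + B)\<^sup>2" by (simp add: power2_sum)
    also have "A + B = (\<Sum>S\<in>Pow (insert j J). (c S)\<^sup>2)"
      using insert.hyps by (simp add: sum_Pow_insert A_def B_def)
    finally show ?case .
  qed
qed


section \<open>Influences control the low-degree Walsh weights\<close>

text \<open>With F the function with coefficients \<open>c\<close> and \<open>m\<close> the left
  side, two applications of Cauchy-Schwarz and hypercontractivity bound the square of
  \<open>m\<close> by the L1 norm of F times its L2 norm times \<open>m\<close>; then one factor
  \<open>m\<close> cancels.\<close>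

lemma noise_L2_bound:
  "(\<Sum>S\<in>Pow {1..n}. (1 / 3) ^ card S * (c S)\<^sup>2)
    \<le> avg n (\<lambda>x. \<bar>walsh {1..n} c x\<bar>) * sqrt (\<Sum>S\<in>Pow {1..n}. (c S)\<^sup>2)"
proof -
  define F where "F = walsh {1..n} c"
  define G where "G = walsh {1..n} (\<lambda>S. (1 / 3) ^ card S * c S)"
  define m where "m = (\<Sum>S\<in>Pow {1..n}. (1 / 3) ^ card S * (c S)\<^sup>2)"
  define Q where "Q = (\<Sum>S\<in>Pow {1..n}. (c S)\<^sup>2)"
  have m0: "m \<ge> 0" and Q0: "Q \<ge> 0" by (auto simp: m_def Q_def intro!: sum_nonneg)
  have "m = avg n (\<lambda>x. F x * G x)"
    unfolding F_def G_def parseval m_def by (simp add: power2_eq_square mult_ac)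
  \<comment> \<open>Splitting the absolute value of \<open>F\<close> into two square roots makes its
    L1 norm appear as one Cauchy-Schwarz factor.\<close>
  also have "\<dots> \<le> avg n (\<lambda>x. sqrt \<bar>F x\<bar> * (sqrt \<bar>F x\<bar> * \<bar>G x\<bar>))"
  proof (rule avg_mono)
    fix x
    have "sqrt \<bar>F x\<bar> * (sqrt \<bar>F x\<bar> * \<bar>G x\<bar>) = \<bar>F x * G x\<bar>"
      by (simp add: abs_mult flip: mult.assoc)
    then show "F x * G x \<le> sqrt \<bar>F x\<bar> * (sqrt \<bar>F x\<bar> * \<bar>G x\<bar>)" by linarith
  qed
  finally have "m\<^sup>2 \<le> (avg n (\<lambda>x. sqrt \<bar>F x\<bar> * (sqrt \<bar>F x\<bar> * \<bar>G x\<bar>)))\<^sup>2"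
    using m0 by (rule power_mono)
  also have "\<dots> \<le> avg n (\<lambda>x. \<bar>F x\<bar>) * avg n (\<lambda>x. \<bar>F x\<bar> * (G x)\<^sup>2)"
    using avg_Cauchy_Schwarz[of n "\<lambda>x. sqrt \<bar>F x\<bar>" "\<lambda>x. sqrt \<bar>F x\<bar> * \<bar>G x\<bar>"]
    by (simp add: power_mult_distrib)
  also have "avg n (\<lambda>x. \<bar>F x\<bar> * (G x)\<^sup>2) \<le> sqrt Q * m"
  proof (rule power2_le_imp_le)
    have "(avg n (\<lambda>x. \<bar>F x\<bar> * (G x)\<^sup>2))\<^sup>2 \<le> avg n (\<lambda>x. (F x)\<^sup>2) * avg n (\<lambda>x. G x ^ 4)"
      using avg_Cauchy_Schwarz[of n "\<lambda>x. \<bar>F x\<bar>" "\<lambda>x. (G x)\<^sup>2"] by (simp flip: power_mult)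
    also have "avg n (\<lambda>x. (F x)\<^sup>2) = Q"
      unfolding Q_def F_def power2_eq_square by (rule parseval)
    \<comment> \<open>The damping 1/3 is (1 / sqrt 3) applied twice. Hypercontractivity absorbs one
      application, and the squared L2 norm after the other is \<open>m\<close> itself.\<close>
    also have "avg n (\<lambda>x. G x ^ 4) \<le> m\<^sup>2"
    proof -
      have *: "(1 / sqrt 3) ^ k * ((1 / sqrt 3) ^ k * y) = (1 / 3) ^ k * y"
        "((1 / sqrt 3) ^ k * y)\<^sup>2 = (1 / 3) ^ k * y\<^sup>2" for k and y :: real
        by (simp_all add: power_mult_distrib power2_eq_square mult_ac flip: mult.assoc power_mult_distrib)
      show ?thesis
        using hypercontractive[of "{1..n}" n "\<lambda>S. (1 / sqrt 3) ^ card S * c S"]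
        unfolding * G_def m_def by simp
    qed
    finally show "(avg n (\<lambda>x. \<bar>F x\<bar> * (G x)\<^sup>2))\<^sup>2 \<le> (sqrt Q * m)\<^sup>2"
      using Q0 by (simp add: power_mult_distrib mult_left_mono)
  qed (use m0 Q0 in simp)
  finally have "m * m \<le> (avg n (\<lambda>x. \<bar>F x\<bar>) * sqrt Q) * m"
    by (simp add: power2_eq_square avg_nonneg mult_left_mono mult.assoc)
  moreover have "0 \<le> avg n (\<lambda>x. \<bar>F x\<bar>) * sqrt Q"
    using Q0 by (simp add: avg_nonneg)
  ultimately have "m \<le> avg n (\<lambda>x. \<bar>F x\<bar>) * sqrt Q"
    using m0 by (cases "m = 0") (auto simp: mult_le_cancel_right)
  then show ?thesis by (simp add: m_def Q_def F_def)
qed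

section \<open>Discrete derivatives and their Walsh coefficients\<close>

text \<open>The derivative of the multilinear expansion in the \<open>k\<close>-th sign variable.
  The leading sign removes the dependence on coordinate \<open>k\<close>, so frequencies lose the
  element \<open>k\<close>.\<close>

definition partial :: "nat \<Rightarrow> ((nat \<Rightarrow> nat) \<Rightarrow> real) \<Rightarrow> (nat \<Rightarrow> nat) \<Rightarrow> real" where
  "partial k f x = (1 - 2 * real (x k)) * (f x - f (flip k x)) / 2"

lemma avg_partial:
  assumes "k \<in> {1..n}"
  shows "avg n (\<lambda>x. \<bar>partial k f x\<bar>) = influence n f k / 2"
proof -
  have "avg n (\<lambda>x. \<bar>partial k f x\<bar>) = avg n (\<lambda>x. 1 / 2 * \<bar>f (flip k x) - f x\<bar>)"
    by (rule avg_cong) (use Omega_cases assms in \<open>force simp: partial_def abs_mult\<close>)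
  then show ?thesis unfolding avg_cmult by (simp add: influence_def expectation_unif)
qed

text \<open>Moving the flip from \<open>f\<close> to the character replaces \<open>chi S\<close> by
  its mean over coordinate \<open>k\<close>. That mean vanishes if \<open>k\<close> lies in
  \<open>S\<close>; otherwise the extra sign turns \<open>chi S\<close> into
  \<open>chi (insert k S)\<close>.\<close>

lemma fourier_partial:
  assumes k: "k \<in> {1..n}" and S: "S \<subseteq> {1..n}"
  shows "fourier n (partial k f) S = (if k \<in> S then 0 else fourier n f (insert k S))"
proof -
  have fin: "finite S" using S finite_subset by blast
  define s where "s x = 1 - 2 * real (x k)" for x :: "nat \<Rightarrow> nat"
  define h where "h x = f (flip k x) * s x * chi S x" for x
  have s: "s (flip k x) = - s x" if "x \<in> Omega n" for x
    using Omega_cases[OF that k] by (auto simp: s_def flip_def)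
  have "fourier n (partial k f) S = avg n (\<lambda>x. 1 / 2 * (f x * s x * chi S x)) - 1 / 2 * avg n h"
    unfolding fourier_def partial_def h_def s_def avg_cmult[symmetric] avg_diff[symmetric]
    by (rule avg_cong) (simp add: field_simps)
  also have "avg n h = avg n (\<lambda>x. h (flip k x))"
    using avg_flip[OF k] by simp
  also have "\<dots> = avg n (\<lambda>x. - (f x * s x * chi S (flip k x)))"
    by (rule avg_cong) (use k in \<open>simp add: h_def s flip_flip\<close>)
  also have "avg n (\<lambda>x. 1 / 2 * (f x * s x * chi S x))
        - 1 / 2 * avg n (\<lambda>x. - (f x * s x * chi S (flip k x)))
      = avg n (\<lambda>x. f x * (s x * ((chi S x + chi S (flip k x)) / 2)))"
    unfolding avg_cmult[symmetric] avg_diff[symmetric]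
    by (rule avg_cong) (simp add: field_simps)
  also have "\<dots> = (if k \<in> S then 0 else fourier n f (insert k S))"
  proof (cases "k \<in> S")
    case True
    then have "avg n (\<lambda>x. f x * (s x * ((chi S x + chi S (flip k x)) / 2))) = avg n (\<lambda>_. 0)"
      by (intro avg_cong) (use k fin in \<open>simp add: chi_flip_in\<close>)
    with True show ?thesis by simp
  next
    case False
    then show ?thesis using fin by (simp add: fourier_def chi_flip_notin chi_insert s_def)
  qed
  finally show ?thesis .
qed

text \<open>Each \<open>S\<close> is reached once for every \<open>k\<close> in it, from the
  frequency \<open>S - {k}\<close> of size \<open>card S - 1\<close>. The empty set contributes 0
  through the factor \<open>card S\<close>.\<close>

lemma sum_fourier_partial:
  "(\<Sum>k\<in>{1..n}. \<Sum>S\<in>Pow {1..n}. w ^ card S * (fourier n (partial k f) S)\<^sup>2)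
    = (\<Sum>S\<in>Pow {1..n}. real (card S) * w ^ (card S - 1) * (fourier n f S)\<^sup>2)"
proof -
  have "(\<Sum>S\<in>Pow {1..n}. w ^ card S * (fourier n (partial k f) S)\<^sup>2)
      = (\<Sum>S\<in>Pow {1..n}. if k \<in> S then w ^ (card S - 1) * (fourier n f S)\<^sup>2 else 0)"
    if k: "k \<in> {1..n}" for k
  proof -
    define J where "J = {1..n} - {k}"
    have J: "{1..n} = insert k J" "finite J" "k \<notin> J" using k by (auto simp: J_def)
    have "(\<Sum>S\<in>Pow {1..n}. w ^ card S * (fourier n (partial k f) S)\<^sup>2)
        = (\<Sum>S\<in>Pow {1..n}. w ^ card S * (if k \<in> S then 0 else fourier n f (insert k S))\<^sup>2)"
      by (intro sum.cong refl) (simp add: fourier_partial[OF k])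
    also have "\<dots> = (\<Sum>S\<in>Pow J. w ^ card S * (fourier n f (insert k S))\<^sup>2)"
      unfolding J(1) sum_Pow_insert[OF J(2,3)] using J(3)
      by (auto intro!: sum.cong)
    also have "\<dots> = (\<Sum>S\<in>Pow {1..n}. if k \<in> S then w ^ (card S - 1) * (fourier n f S)\<^sup>2 else 0)"
    proof -
      have "card (insert k S) - 1 = card S" if "S \<subseteq> J" for S
        using that J finite_subset by (subst card_insert_disjoint) auto
      moreover have "(\<Sum>S\<in>Pow J. if k \<in> S then w ^ (card S - 1) * (fourier n f S)\<^sup>2 else 0) = 0"
        using J(3) by (intro sum.neutral) auto
      ultimately show ?thesis
        unfolding J(1) sum_Pow_insert[OF J(2,3)] by (auto intro!: sum.cong)
    qed
    finally show ?thesis .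
  qed
  then have "(\<Sum>k\<in>{1..n}. \<Sum>S\<in>Pow {1..n}. w ^ card S * (fourier n (partial k f) S)\<^sup>2)
      = (\<Sum>k\<in>{1..n}. \<Sum>S\<in>Pow {1..n}. if k \<in> S then w ^ (card S - 1) * (fourier n f S)\<^sup>2 else 0)"
    by (rule sum.cong[OF refl])
  also have "\<dots> = (\<Sum>S\<in>Pow {1..n}. \<Sum>k\<in>{1..n}. if k \<in> S then w ^ (card S - 1) * (fourier n f S)\<^sup>2 else 0)"
    by (rule sum.swap)
  also have "\<dots> = (\<Sum>S\<in>Pow {1..n}. real (card S) * w ^ (card S - 1) * (fourier n f S)\<^sup>2)"
  proof (intro sum.cong refl)
    fix S assume "S \<in> Pow {1..n}"
    then have "{1..n} \<inter> S = S" by blast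
    then show "(\<Sum>k\<in>{1..n}. if k \<in> S then w ^ (card S - 1) * (fourier n f S)\<^sup>2 else 0)
        = real (card S) * w ^ (card S - 1) * (fourier n f S)\<^sup>2"
      by (subst sum.inter_restrict[symmetric]) simp_all
  qed
  finally show ?thesis .
qed

lemma parseval_fourier: "(\<Sum>S\<in>Pow {1..n}. (fourier n f S)\<^sup>2) = avg n (\<lambda>x. (f x)\<^sup>2)"
  unfolding power2_eq_square parseval[symmetric]
  by (rule avg_cong) (simp only: fourier_inversion)

text \<open>The factor 1/6 is 1/2 times 1/3: the 1/2 comes from smoothing the derivatives by 1 /
  sqrt 2, which keeps their squared norms summable independently of the degree, and the 1/3 comes
  from \<open>noise_L2_bound\<close>.\<close>

lemma weight_le_influences:
  assumes f: "avg n (\<lambda>x. (f x)\<^sup>2) \<le> 1"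
  shows "(\<Sum>S\<in>Pow {1..n} - {{}}. (fourier n f S)\<^sup>2 * (1 / 6) ^ card S) \<le> sqrt (II n f)"
proof -
  define c where "c k S = (1 / sqrt 2) ^ card S * fourier n (partial k f) S" for k S
  have c2: "(c k S)\<^sup>2 = (1 / 2) ^ card S * (fourier n (partial k f) S)\<^sup>2" for k S
  proof -
    have "((1 / sqrt 2) ^ card S)\<^sup>2 = ((1 / sqrt 2)\<^sup>2) ^ card S" by (simp flip: power_mult add: mult.commute)
    also have "(1 / sqrt 2)\<^sup>2 = 1 / 2" by (simp add: power_divide)
    finally show ?thesis by (simp add: c_def power_mult_distrib)
  qed
  have c26: "(1 / 3) ^ card S * (c k S)\<^sup>2 = (1 / 6) ^ card S * (fourier n (partial k f) S)\<^sup>2" for k S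
    unfolding c2 by (simp add: power_mult_distrib[symmetric] flip: mult.assoc)
  define Q where "Q k = (\<Sum>S\<in>Pow {1..n}. (c k S)\<^sup>2)" for k
  have Q0: "Q k \<ge> 0" for k by (simp add: Q_def sum_nonneg)
  have I0: "influence n f k \<ge> 0" for k
    unfolding influence_def expectation_unif by (simp add: avg_nonneg)
  have "(\<Sum>k\<in>{1..n}. Q k)
      = (\<Sum>S\<in>Pow {1..n}. real (card S) * (1 / 2) ^ (card S - 1) * (fourier n f S)\<^sup>2)"
    unfolding Q_def c2 by (rule sum_fourier_partial)
  also have "\<dots> \<le> (\<Sum>S\<in>Pow {1..n}. 1 * (fourier n f S)\<^sup>2)"
  proof (intro sum_mono mult_right_mono)
    fix S :: "nat set"
    have "real k \<le> 2 ^ (k - 1)" for k :: nat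
    proof (cases k)
      case (Suc j)
      have "Suc j \<le> 2 ^ j" using less_exp[of j] by (rule Suc_leI)
      then show ?thesis using Suc of_nat_le_iff[of "Suc j" "2 ^ j"] by simp
    qed simp
    then show "real (card S) * (1 / 2) ^ (card S - 1) \<le> 1"
      by (simp add: power_one_over field_simps)
  qed simp
  also have "\<dots> \<le> 1" using f parseval_fourier[of n f] by simp
  finally have Q1: "(\<Sum>k\<in>{1..n}. Q k) \<le> 1" .
  \<comment> \<open>A nonempty \<open>S\<close> has \<open>card S\<close> at least 1, so the weights
    can be enlarged to the form that arises from summing over all derivatives.\<close>
  have "(\<Sum>S\<in>Pow {1..n} - {{}}. (fourier n f S)\<^sup>2 * (1 / 6) ^ card S)
      \<le> (\<Sum>S\<in>Pow {1..n} - {{}}. real (card S) * (1 / 6) ^ (card S - 1) * (fourier n f S)\<^sup>2)"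
  proof (rule sum_mono)
    fix S assume S: "S \<in> Pow {1..n} - {{}}"
    then have "card S \<ge> 1" by (metis Diff_iff PowD One_nat_def Suc_leI card_gt_0_iff finite_atLeastAtMost finite_subset insertI1)
    then have "(1 / 6 :: real) ^ card S \<le> 1 * (1 / 6) ^ (card S - 1)"
      by (simp add: power_decreasing)
    also have "\<dots> \<le> real (card S) * (1 / 6) ^ (card S - 1)"
      using \<open>card S \<ge> 1\<close> by (intro mult_right_mono) auto
    finally show "(fourier n f S)\<^sup>2 * (1 / 6) ^ card S
        \<le> real (card S) * (1 / 6) ^ (card S - 1) * (fourier n f S)\<^sup>2"
      by (simp add: mult_left_mono mult.commute)
  qed
  also have "\<dots> \<le> (\<Sum>S\<in>Pow {1..n}. real (card S) * (1 / 6) ^ (card S - 1) * (fourier n f S)\<^sup>2)"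
    by (rule sum_mono2) auto
  also have "\<dots> = (\<Sum>k\<in>{1..n}. \<Sum>S\<in>Pow {1..n}. (1 / 3) ^ card S * (c k S)\<^sup>2)"
    unfolding c26 by (rule sum_fourier_partial[symmetric])
  also have "\<dots> \<le> (\<Sum>k\<in>{1..n}. influence n f k * sqrt (Q k))"
  proof (rule sum_mono)
    fix k assume k: "k \<in> {1..n}"
    \<comment> \<open>The smoothing that controls the L2 norms costs nothing in L1.\<close>
    have "avg n (\<lambda>x. \<bar>walsh {1..n} (c k) x\<bar>) \<le> avg n (\<lambda>x. \<bar>partial k f x\<bar>)"
      unfolding c_def by (rule noise_L1_contraction) auto
    also have "\<dots> \<le> influence n f k" using avg_partial[OF k, of f] I0[of k] by simp
    finally have "avg n (\<lambda>x. \<bar>walsh {1..n} (c k) x\<bar>) * sqrt (Q k) \<le> influence n f k * sqrt (Q k)"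
      using Q0 by (intro mult_right_mono) auto
    then show "(\<Sum>S\<in>Pow {1..n}. (1 / 3) ^ card S * (c k S)\<^sup>2) \<le> influence n f k * sqrt (Q k)"
      using noise_L2_bound[of "c k" n] unfolding Q_def by linarith
  qed
  also have "\<dots> \<le> sqrt (II n f)"
  proof (rule real_le_rsqrt)
    have "(\<Sum>k\<in>{1..n}. influence n f k * sqrt (Q k))\<^sup>2 \<le> II n f * (\<Sum>k\<in>{1..n}. Q k)"
      using Cauchy_Schwarz_ineq_sum[of "influence n f" "\<lambda>k. sqrt (Q k)" "{1..n}"] Q0
      by (simp add: II_def)
    also have "\<dots> \<le> II n f * 1"
      using Q1 by (intro mult_left_mono) (auto simp: II_def intro: sum_nonneg)
    finally show "(\<Sum>k\<in>{1..n}. influence n f k * sqrt (Q k))\<^sup>2 \<le> II n f" by simp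
  qed
  finally show ?thesis .
qed

section \<open>Passing from one noise level to another by concavity\<close>

text \<open>Jensen's inequality for the concave power \<open>s\<close>, with weights of total mass
  at most 1. The tangent line at \<open>c\<close> has nonnegative slope and intercept, so upper
  bounds on the mass and on the weighted sum suffice. For \<open>c = 0\<close> all the weights
  vanish.\<close>

lemma sum_powr_le:
  fixes p w :: "'a \<Rightarrow> real"
  assumes p: "\<And>i. i \<in> I \<Longrightarrow> 0 \<le> p i" "sum p I \<le> 1"
    and w: "\<And>i. i \<in> I \<Longrightarrow> 0 < w i" "(\<Sum>i\<in>I. p i * w i) \<le> c"
    and s: "0 < s" "s \<le> 1" and fin: "finite I"
  shows "(\<Sum>i\<in>I. p i * w i powr s) \<le> c powr s"
proof -
  have c0: "0 \<le> c"
    by (rule order_trans[OF sum_nonneg w(2)]) (simp add: p(1) w(1) less_imp_le)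
  show ?thesis
  proof (cases "c = 0")
    case True
    then have "(\<Sum>i\<in>I. p i * w i) = 0"
      using w p(1) by (intro antisym sum_nonneg) (auto simp: less_imp_le)
    then have "p i * w i = 0" if "i \<in> I" for i
      using that fin p(1) w(1) by (subst (asm) sum_nonneg_eq_0_iff) (auto simp: less_imp_le)
    then have "(\<Sum>i\<in>I. p i * w i powr s) = 0"
      using w(1) by (intro sum.neutral) force
    then show ?thesis by simp
  next
    case False
    with c0 have c: "0 < c" by simp
    \<comment> \<open>The tangent-line bound at \<open>c\<close>, obtained from Young's inequality
      with second factor 1.\<close>
    have "w i powr s \<le> c powr s * (s * (w i / c) + (1 - s))" if "i \<in> I" for i
    proof -
      have "(w i / c) powr s * 1 powr (1 - s) \<le> s * (w i / c) + (1 - s) * 1"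
        by (rule Youngs_inequality_0) (use s w(1)[OF that] c in auto)
      then have "c powr s * (w i / c) powr s \<le> c powr s * (s * (w i / c) + (1 - s))"
        by (intro mult_left_mono) auto
      then show ?thesis
        using c w(1)[OF that] by (simp add: powr_mult[symmetric])
    qed
    then have "(\<Sum>i\<in>I. p i * w i powr s)
        \<le> (\<Sum>i\<in>I. p i * (c powr s * (s * (w i / c) + (1 - s))))"
      using p(1) by (intro sum_mono mult_left_mono) auto
    also have "\<dots> = c powr s * (s * ((\<Sum>i\<in>I. p i * w i) / c) + (1 - s) * sum p I)"
      by (simp add: sum_distrib_left sum_divide_distrib sum.distrib[symmetric] algebra_simps
          sum_subtractf[symmetric])
    also have "\<dots> \<le> c powr s * (s * 1 + (1 - s) * 1)"
      using w(2) p(2) c s by (intro mult_left_mono add_mono) auto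
    finally show ?thesis by simp
  qed
qed

section \<open>The sensitivity gauge\<close>

text \<open>The largest \<open>s \<le> 1\<close> with \<open>(1 - 2 * \<epsilon>)\<^sup>2 \<le> (1 / 6) powr s\<close>.\<close>

definition gauge_exponent :: "real \<Rightarrow> real" where
  "gauge_exponent \<epsilon> = min 1 (- 2 * ln (1 - 2 * \<epsilon>) / ln 6)"

lemma gauge_exponent:
  assumes "\<epsilon> \<in> {0<..<1/2}"
  shows "0 < gauge_exponent \<epsilon>" "gauge_exponent \<epsilon> \<le> 1"
    "(1 - 2 * \<epsilon>)\<^sup>2 \<le> (1 / 6) powr gauge_exponent \<epsilon>"
proof -
  have \<rho>: "0 < 1 - 2 * \<epsilon>" "1 - 2 * \<epsilon> < 1" using assms by auto
  then have "ln (1 - 2 * \<epsilon>) < 0" by simp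
  then show "0 < gauge_exponent \<epsilon>"
    by (simp add: gauge_exponent_def divide_neg_pos)
  show "gauge_exponent \<epsilon> \<le> 1" by (simp add: gauge_exponent_def)
  have "gauge_exponent \<epsilon> * ln 6 \<le> (- 2 * ln (1 - 2 * \<epsilon>) / ln 6) * ln 6"
    unfolding gauge_exponent_def by (intro mult_right_mono) auto
  then have "2 * ln (1 - 2 * \<epsilon>) \<le> gauge_exponent \<epsilon> * ln (1 / 6)"
    by (simp add: ln_div)
  then have "exp (2 * ln (1 - 2 * \<epsilon>)) \<le> (1 / 6) powr gauge_exponent \<epsilon>"
    by (simp add: powr_def)
  then show "(1 - 2 * \<epsilon>)\<^sup>2 \<le> (1 / 6) powr gauge_exponent \<epsilon>"
    using \<rho> by (simp add: exp_double)
qed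

text \<open>The mean is the coefficient at the empty set; subtracting it leaves the other damped
  coefficients for Parseval.\<close>

lemma noise_variance:
  "avg n (\<lambda>x. (walsh {1..n} (\<lambda>S. \<rho> ^ card S * fourier n f S) x - avg n f)\<^sup>2)
    = (\<Sum>S\<in>Pow {1..n} - {{}}. (fourier n f S)\<^sup>2 * (\<rho>\<^sup>2) ^ card S)"
proof -
  define c where "c S = (if S = {} then 0 else \<rho> ^ card S * fourier n f S)" for S
  have "walsh {1..n} (\<lambda>S. \<rho> ^ card S * fourier n f S) x - avg n f = walsh {1..n} c x" for x
  proof -
    have "walsh {1..n} c x = (\<Sum>S\<in>Pow {1..n} - {{}}. \<rho> ^ card S * fourier n f S * chi S x)"
      unfolding walsh_def by (rule sum.mono_neutral_cong_right) (auto simp: c_def)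
    moreover have "walsh {1..n} (\<lambda>S. \<rho> ^ card S * fourier n f S) x
        = avg n f + (\<Sum>S\<in>Pow {1..n} - {{}}. \<rho> ^ card S * fourier n f S * chi S x)"
      unfolding walsh_def by (subst sum.remove[of _ "{}"]) (auto simp: fourier_def chi_def)
    ultimately show ?thesis by simp
  qed
  then have "avg n (\<lambda>x. (walsh {1..n} (\<lambda>S. \<rho> ^ card S * fourier n f S) x - avg n f)\<^sup>2)
      = (\<Sum>S\<in>Pow {1..n}. c S * c S)"
    by (simp only: power2_eq_square parseval)
  also have "\<dots> = (\<Sum>S\<in>Pow {1..n} - {{}}. (fourier n f S)\<^sup>2 * (\<rho>\<^sup>2) ^ card S)"
    by (rule sum.mono_neutral_cong_right) 
       (auto simp: c_def power2_eq_square power_mult_distrib mult_ac)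
  finally show ?thesis .
qed

text \<open>The choice of \<open>gauge_exponent\<close> compares the damping at \<epsilon> with a
  power of the damping 1/6, and \<open>sum_powr_le\<close> moves that power outside the sum. The
  exponent is halved by the square root in \<open>weight_le_influences\<close>.\<close>

lemma noise_variance_le:
  assumes f: "avg n (\<lambda>x. (f x)\<^sup>2) \<le> 1" and \<epsilon>: "\<epsilon> \<in> {0<..<1/2}"
  shows "avg n (\<lambda>x. (walsh {1..n} (\<lambda>S. (1 - 2 * \<epsilon>) ^ card S * fourier n f S) x - avg n f)\<^sup>2)
    \<le> II n f powr (gauge_exponent \<epsilon> / 2)"
proof -
  have II0: "II n f \<ge> 0" by (simp add: II_def sum_nonneg)
  have "(\<Sum>S\<in>Pow {1..n} - {{}}. (fourier n f S)\<^sup>2 * ((1 - 2 * \<epsilon>)\<^sup>2) ^ card S)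
      \<le> (\<Sum>S\<in>Pow {1..n} - {{}}. (fourier n f S)\<^sup>2 * ((1 / 6) ^ card S) powr gauge_exponent \<epsilon>)"
  proof (intro sum_mono mult_left_mono)
    fix S :: "nat set"
    have "((1 - 2 * \<epsilon>)\<^sup>2) ^ card S \<le> ((1 / 6) powr gauge_exponent \<epsilon>) ^ card S"
      by (intro power_mono gauge_exponent(3)[OF \<epsilon>]) auto
    also have "\<dots> = ((1 / 6) ^ card S) powr gauge_exponent \<epsilon>"
      by (simp add: powr_realpow[symmetric] powr_powr mult.commute)
    finally show "((1 - 2 * \<epsilon>)\<^sup>2) ^ card S \<le> ((1 / 6) ^ card S) powr gauge_exponent \<epsilon>" .
  qed simp
  also have "\<dots> \<le> sqrt (II n f) powr gauge_exponent \<epsilon>"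
  proof (rule sum_powr_le)
    have "(\<Sum>S\<in>Pow {1..n} - {{}}. (fourier n f S)\<^sup>2) \<le> (\<Sum>S\<in>Pow {1..n}. (fourier n f S)\<^sup>2)"
      by (rule sum_mono2) auto
    also have "\<dots> \<le> 1" using f by (simp only: parseval_fourier)
    finally show "(\<Sum>S\<in>Pow {1..n} - {{}}. (fourier n f S)\<^sup>2) \<le> 1" .
  qed (use weight_le_influences[OF f] gauge_exponent[OF \<epsilon>] in auto)
  also have "\<dots> = II n f powr (gauge_exponent \<epsilon> / 2)"
    using II0 by (simp add: powr_half_sqrt[symmetric] powr_powr)
  finally show ?thesis by (simp only: noise_variance)
qed

section \<open>From the noise operator to the sensitivity gauge\<close>

lemma noise_prob:
  assumes x: "x \<in> Omega n" and A: "A \<subseteq> Omega n" and \<epsilon>: "\<epsilon> \<in> {0<..<1/2}"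
  shows "measure_pmf.prob (noise n \<epsilon> x) A
    = walsh {1..n} (\<lambda>S. (1 - 2 * \<epsilon>) ^ card S * fourier n (indicat_real A) S) x"
proof -
  have pmf: "pmf (noise n \<epsilon> x) z = kernel n (1 - 2 * \<epsilon>) x z" if z: "z \<in> Omega n" for z
  proof -
    \<comment> \<open>Points of the cube agree off the index set with the default value of the
      product distribution, so the product formula for its mass applies.\<close>
    have "z j = undefined" if "j \<notin> {1..n}" for j
      using z that by (auto simp: Omega_def PiE_def extensional_def)
    then have "pmf (noise n \<epsilon> x) z
        = (\<Prod>j\<in>{1..n}. pmf (map_pmf (\<lambda>b. if b then 1 - x j else x j) (bernoulli_pmf \<epsilon>)) (z j))"
      unfolding noise_def by (intro pmf_Pi') auto
    also have "\<dots> = kernel n (1 - 2 * \<epsilon>) x z"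
      unfolding kernel_def
    proof (intro prod.cong refl)
      fix j assume j: "j \<in> {1..n}"
      \<comment> \<open>A bit differs from its complement, so exactly one outcome of the coin leads
        to \<open>z j\<close>.\<close>
      have v: "(\<lambda>b. if b then 1 - x j else x j) -` {z j} = (if z j = x j then {False} else {True})"
        using Omega_cases[OF x j] Omega_cases[OF z j] by (auto split: if_splits)
      show "pmf (map_pmf (\<lambda>b. if b then 1 - x j else x j) (bernoulli_pmf \<epsilon>)) (z j)
          = (1 + (1 - 2 * \<epsilon>) * (1 - 2 * real (x j)) * (1 - 2 * real (z j))) / 2"
        unfolding pmf_map v using Omega_cases[OF x j] Omega_cases[OF z j] \<epsilon>
        by (auto simp: measure_pmf_single)
    qed
    finally show ?thesis .
  qed
  have finA: "finite A" using A finite_Omega finite_subset by blast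
  have "measure_pmf.prob (noise n \<epsilon> x) A = (\<Sum>z\<in>A. kernel n (1 - 2 * \<epsilon>) x z)"
    using A by (subst measure_measure_pmf_finite[OF finA]) (auto intro!: sum.cong pmf)
  also have "\<dots> = (\<Sum>z\<in>Omega n. kernel n (1 - 2 * \<epsilon>) x z * indicat_real A z)"
    by (rule sum.mono_neutral_cong_left) (use A in auto)
  finally show ?thesis by (simp only: noise_kernel)
qed

lemma prob_unif: "measure_pmf.prob (unif n) A = avg n (indicat_real A)"
  by (simp flip: expectation_unif)

text \<open>Chebyshev's inequality for the noisy conditional probability, whose mean is the
  probability of \<open>A\<close>.\<close>

lemma gauge_prob_le:
  assumes A: "A \<subseteq> Omega n" and \<epsilon>: "\<epsilon> \<in> {0<..<1/2}" and \<delta>: "\<delta> > 0"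
  shows "gauge_prob n A \<epsilon> \<delta> \<le> II_event n A powr (gauge_exponent \<epsilon> / 2) / \<delta>\<^sup>2"
proof -
  define g where "g x = walsh {1..n} (\<lambda>S. (1 - 2 * \<epsilon>) ^ card S * fourier n (indicat_real A) S) x
    - avg n (indicat_real A)" for x
  have "gauge_prob n A \<epsilon> \<delta> = avg n (indicat_real {x \<in> Omega n. \<bar>g x\<bar> > \<delta>})"
    unfolding gauge_prob_def prob_unif
    by (rule arg_cong[where f = "\<lambda>X. avg n (indicat_real X)"])
       (auto simp: g_def noise_prob[OF _ A \<epsilon>])
  also have "\<dots> \<le> avg n (\<lambda>x. 1 / \<delta>\<^sup>2 * (g x)\<^sup>2)"
  proof (rule avg_mono)
    fix x
    have "\<delta>\<^sup>2 \<le> (g x)\<^sup>2" if "\<bar>g x\<bar> > \<delta>"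
      using that \<delta> power_mono[of \<delta> "\<bar>g x\<bar>" 2] by simp
    then show "indicat_real {x \<in> Omega n. \<bar>g x\<bar> > \<delta>} x \<le> 1 / \<delta>\<^sup>2 * (g x)\<^sup>2"
      using \<delta> by (auto simp: indicator_def)
  qed
  also have "\<dots> = avg n (\<lambda>x. (g x)\<^sup>2) / \<delta>\<^sup>2"
    by (simp only: avg_cmult) simp
  also have "avg n (\<lambda>x. (g x)\<^sup>2) \<le> II_event n A powr (gauge_exponent \<epsilon> / 2)"
    unfolding g_def II_event_def
  proof (rule noise_variance_le[OF _ \<epsilon>])
    have "avg n (\<lambda>x. (indicat_real A x)\<^sup>2) \<le> avg n (\<lambda>_. 1)"
      by (rule avg_mono) (auto simp: indicator_def)
    then show "avg n (\<lambda>x. (indicat_real A x)\<^sup>2) \<le> 1" by simp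
  qed
  finally show ?thesis using \<delta> by (simp add: divide_right_mono)
qed

lemma sens_gauge_nonneg: "0 \<le> sens_gauge n A \<epsilon>"
  unfolding sens_gauge_def
proof (rule cInf_greatest)
  \<comment> \<open>The infimum is meaningful only over a nonempty set; \<delta> = 2 belongs to it
    because a probability is at most 1.\<close>
  have "gauge_prob n A \<epsilon> 2 \<le> 1" by (simp add: gauge_prob_def)
  then have "2 \<in> {\<delta>. \<delta> > 0 \<and> gauge_prob n A \<epsilon> \<delta> < \<delta>}" by simp
  then show "{\<delta>. \<delta> > 0 \<and> gauge_prob n A \<epsilon> \<delta> < \<delta>} \<noteq> {}" by blast
qed auto

text \<open>With \<open>V\<close> the variance bound, Chebyshev gives a gauge probability below
  \<delta> as soon as the cube of \<delta> exceeds \<open>V\<close>. The threshold is the cube root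
  of \<open>V\<close>, which turns the exponent's divisor 2 into 6.\<close>

lemma sens_gauge_le:
  assumes A: "A \<subseteq> Omega n" and \<epsilon>: "\<epsilon> \<in> {0<..<1/2}"
  shows "sens_gauge n A \<epsilon> \<le> II_event n A powr (gauge_exponent \<epsilon> / 6)"
proof (rule dense_ge)
  define V where "V = II_event n A powr (gauge_exponent \<epsilon> / 2)"
  fix \<delta> assume \<delta>: "II_event n A powr (gauge_exponent \<epsilon> / 6) < \<delta>"
  then have \<delta>0: "\<delta> > 0" using powr_ge_zero le_less_trans by blast
  have "V = (II_event n A powr (gauge_exponent \<epsilon> / 6)) ^ 3"
    by (simp add: V_def power3_eq_cube flip: powr_add)
  also have "\<dots> < \<delta> ^ 3" using \<delta> by (intro power_strict_mono) auto
  finally have "V / \<delta>\<^sup>2 < \<delta>"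
    using \<delta>0 by (simp add: field_simps eval_nat_numeral)
  then have "gauge_prob n A \<epsilon> \<delta> < \<delta>"
    using gauge_prob_le[OF A \<epsilon> \<delta>0] by (simp add: V_def)
  then show "sens_gauge n A \<epsilon> \<le> \<delta>"
    unfolding sens_gauge_def using \<delta>0 by (intro cInf_lower bdd_belowI[of _ 0]) auto
qed

theorem theorem1p3:
  shows "(\<forall>(n :: nat \<Rightarrow> nat) (A :: nat \<Rightarrow> (nat \<Rightarrow> nat) set).
            (\<forall>m\<ge>1. n m \<ge> 1 \<and> A m \<subseteq> Omega (n m)) \<longrightarrow>
            (\<lambda>m. II_event (n m) (A m)) \<longlonglongrightarrow> 0 \<longrightarrow>
            asymp_noise_sensitive n A)
       \<and> (\<exists>\<Phi> :: real \<times> real \<Rightarrow> real.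
            continuous_on ({0..} \<times> {0<..<1/2}) \<Phi> \<and>
            \<Phi> \<in> {0..} \<times> {0<..<1/2} \<rightarrow> {0..} \<and>
            (\<forall>\<epsilon>\<in>{0<..<1/2}. \<Phi> (0, \<epsilon>) = 0) \<and>
            (\<forall>n\<ge>1. \<forall>A. A \<subseteq> Omega n \<longrightarrow>
               (\<forall>\<epsilon>\<in>{0<..<1/2}. sens_gauge n A \<epsilon> \<le> \<Phi> (II_event n A, \<epsilon>))))"
proof (rule conjI)
  show "\<forall>(n :: nat \<Rightarrow> nat) (A :: nat \<Rightarrow> (nat \<Rightarrow> nat) set).
            (\<forall>m\<ge>1. n m \<ge> 1 \<and> A m \<subseteq> Omega (n m)) \<longrightarrow>
            (\<lambda>m. II_event (n m) (A m)) \<longlonglongrightarrow> 0 \<longrightarrow>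
            asymp_noise_sensitive n A"
    unfolding asymp_noise_sensitive_def
  proof (intro allI impI ballI)
    fix n :: "nat \<Rightarrow> nat" and A :: "nat \<Rightarrow> (nat \<Rightarrow> nat) set" and \<epsilon> :: real
    assume A: "\<forall>m\<ge>1. n m \<ge> 1 \<and> A m \<subseteq> Omega (n m)"
      and lim: "(\<lambda>m. II_event (n m) (A m)) \<longlonglongrightarrow> 0" and \<epsilon>: "\<epsilon> \<in> {0<..<1/2}"
    have "(\<lambda>m. II_event (n m) (A m) powr (gauge_exponent \<epsilon> / 6)) \<longlonglongrightarrow> 0 powr (gauge_exponent \<epsilon> / 6)"
      by (rule tendsto_powr'[OF lim tendsto_const])
         (use gauge_exponent(1)[OF \<epsilon>] in \<open>simp add: II_event_def II_def sum_nonneg\<close>)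
    then have *: "(\<lambda>m. II_event (n m) (A m) powr (gauge_exponent \<epsilon> / 6)) \<longlonglongrightarrow> 0"
      by simp
    show "(\<lambda>m. sens_gauge (n m) (A m) \<epsilon>) \<longlonglongrightarrow> 0"
    proof (rule tendsto_sandwich[OF _ _ tendsto_const *])
      \<comment> \<open>The sets are assumed to be events only from index 1 on, so the bound is
        stated eventually.\<close>
      show "\<forall>\<^sub>F m in sequentially.
          sens_gauge (n m) (A m) \<epsilon> \<le> II_event (n m) (A m) powr (gauge_exponent \<epsilon> / 6)"
        by (rule eventually_sequentiallyI[of 1]) (use A sens_gauge_le[OF _ \<epsilon>] in blast)
    qed (simp add: sens_gauge_nonneg)
  qed
  \<comment> \<open>The witness is the bound of \<open>sens_gauge_le\<close>. Positivity of the
    exponent gives joint continuity up to the boundary t = 0, where the value is 0.\<close>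
  let ?\<Phi> = "\<lambda>(t :: real, \<epsilon>). t powr (gauge_exponent \<epsilon> / 6)"
  have "continuous_on ({0..} \<times> {0<..<1/2}) ?\<Phi>"
    unfolding case_prod_beta
  proof (rule continuous_on_powr')
    show "continuous_on ({0..} \<times> {0<..<1/2}) (\<lambda>p :: real \<times> real. gauge_exponent (snd p) / 6)"
      unfolding gauge_exponent_def by (intro continuous_intros) auto
  qed (auto intro: continuous_intros simp: gauge_exponent)
  moreover have "\<forall>n\<ge>1. \<forall>A. A \<subseteq> Omega n \<longrightarrow>
      (\<forall>\<epsilon>\<in>{0<..<1/2}. sens_gauge n A \<epsilon> \<le> ?\<Phi> (II_event n A, \<epsilon>))"
    by (simp add: sens_gauge_le)
  ultimately show "\<exists>\<Phi> :: real \<times> real \<Rightarrow> real.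
            continuous_on ({0..} \<times> {0<..<1/2}) \<Phi> \<and>
            \<Phi> \<in> {0..} \<times> {0<..<1/2} \<rightarrow> {0..} \<and>
            (\<forall>\<epsilon>\<in>{0<..<1/2}. \<Phi> (0, \<epsilon>) = 0) \<and>
            (\<forall>n\<ge>1. \<forall>A. A \<subseteq> Omega n \<longrightarrow>
               (\<forall>\<epsilon>\<in>{0<..<1/2}. sens_gauge n A \<epsilon> \<le> \<Phi> (II_event n A, \<epsilon>)))"
    by (intro exI[of _ ?\<Phi>]) auto
qed

end
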